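(* Let $\alpha\in(\tfrac12,1)$ and let $c_\alpha\in(0,\tfrac{\pi}{2}]$ be the number with $\frac{\sin(2c_\alpha)}{2c_\alpha}=\alpha^2$. Let $T>0$, let $u$ be a sufficiently smooth solution of the continuous problem on $[0,1]\times[0,T]$ with initial condition $u_0$, and let $(\mathbf u^n)_{0\le n\le M}$ be the solution of the discrete scheme with spatial mesh size $h=\frac1{N+1}$ and time step $\Delta t=\frac TM$, $N,M\in\mathbb N$ (all as described in the context). Assume $\|\mathbf u^0\|_\infty\le c_\alpha$ and define $d_\alpha:=\|D^{-\alpha}\mathbf u^0\|_\infty$. Then the error $\mathbf e^n:=\mathbf u(t_n)-\mathbf u^n$, where $t_n=n\Delta t$ and $\mathbf u(t):=(u(x_1,t),\ldots,u(x_N,t))^T$, satisfies $$\|\mathbf e^n\|_{D,h}\le c\,\big(\Delta t+h^2|\ln h|^{1/2}\big),\qquad 1\le n\le M,$$ with a constant $c$ that depends only on $\big\|\frac{\partial^j u}{\partial x^j}\big\|_{L^\infty([0,1]\times[0,T])}$ for $0\le j\le4$, $\big\|\frac{\partial^j u}{\partial t^j}\big\|_{L^\infty([0,1]\times[0,T])}$ for $0\le j\le2$, $T$, $\alpha$, $c_\alpha$ and $d_\alpha$ (that is, $c$ is a function of these quantities only; apart from the dependence through $d_\alpha$ it does not depend on $N$, $M$ or $n$).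
   Context: Continuous problem. Let $I=[0,1]$ and $u_0:I\to\mathbb R$ with $u_0(0)=u_0(1)=0$. The problem is to find $u:I\times[0,T]\to\mathbb R$ with $$u_t=u_{xx}+\frac1x u_x-\frac{\sin(2u)}{2x^2}$$ (the equation being imposed for $x>0$), $u(\cdot,0)=u_0$ on $I$, and $u(0,t)=u(1,t)=0$ for $t\in[0,T]$. "Sufficiently smooth" means that the partial derivatives $\partial_x^j u$ ($0\le j\le4$) and $\partial_t^j u$ ($0\le j\le2$) exist and are continuous on $I\times[0,T]$ (so the $L^\infty$ norms in the claim are finite). Discretization. Let $N\in\mathbb N$, $h=\frac{1}{N+1}$, $x_i=ih$ for $0\le i\le N+1$. Define the $N\times N$ matrices $$A=\frac1{h^2}\mathrm{tridiag}(-1,2,-1),\quad B=\frac1{2h}\mathrm{tridiag}(-1,0,1),\quad D=\mathrm{diag}(x_1,\ldots,x_N),\quad C=A-D^{-1}B.$$ For $\mathbf u=(u_1,\ldots,u_N)^T\in\mathbb R^N$ let $G(\mathbf u)=\mathrm{diag}\big(\frac{\sin(2u_1)}{2u_1},\ldots,\frac{\sin(2u_N)}{2u_N}\big)$, with the convention that $\frac{\sin(2y)}{2y}=1$ at $y=0$. Let $M\in\mathbb N$ and $\Delta t=\frac TM$. The scheme is: $\mathbf u^0=(u_0(x_1),\ldots,u_0(x_N))^T$ and $$\frac{\mathbf u^{n+1}-\mathbf u^n}{\Delta t}=-C\mathbf u^{n+1}-G(\mathbf u^n)D^{-2}\mathbf u^{n+1},\qquad 0\le n\le M-1.$$ Norms.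 For $\mathbf v\in\mathbb R^N$: $\|\mathbf v\|_\infty=\max_i|v_i|$ and $\|\mathbf v\|_{D,h}^2=h\sum_{i=1}^N x_i v_i^2$. $D^{-\alpha}=\mathrm{diag}(x_1^{-\alpha},\ldots,x_N^{-\alpha})$. *)

theory Defs
  imports
    "HOL-Analysis.Analysis"
    "HOL-Probability.Essential_Supremum"
    "Jordan_Normal_Form.Matrix"
begin

unbundle no vec_syntax

section \<open>The continuous problem\<close>

text \<open>Functions on \<open>[0,1] \<times> [0,T]\<close> are curried total functions; all partial derivatives are taken
  relative to the closed intervals (one-sided at the end points), so that values outside the
  rectangle are irrelevant.\<close>

primrec partial_x :: "nat \<Rightarrow> (real \<Rightarrow> real \<Rightarrow> real) \<Rightarrow> real \<Rightarrow> real \<Rightarrow> real" where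
  "partial_x 0 u = u"
| "partial_x (Suc j) u =
     (\<lambda>x t. vector_derivative (\<lambda>y. partial_x j u y t) (at x within {0..1}))"

primrec partial_t :: "real \<Rightarrow> nat \<Rightarrow> (real \<Rightarrow> real \<Rightarrow> real) \<Rightarrow> real \<Rightarrow> real \<Rightarrow> real" where
  "partial_t T 0 u = u"
| "partial_t T (Suc j) u =
     (\<lambda>x t. vector_derivative (\<lambda>s. partial_t T j u x s) (at t within {0..T}))"

definition sufficiently_smooth :: "real \<Rightarrow> (real \<Rightarrow> real \<Rightarrow> real) \<Rightarrow> bool" where
  "sufficiently_smooth T u \<longleftrightarrow>
     (\<forall>j<4. \<forall>x\<in>{0..1}. \<forall>t\<in>{0..T}.
        (\<lambda>y. partial_x j u y t) differentiable (at x within {0..1})) \<and>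
     (\<forall>j<2. \<forall>x\<in>{0..1}. \<forall>t\<in>{0..T}.
        (\<lambda>s. partial_t T j u x s) differentiable (at t within {0..T})) \<and>
     (\<forall>j\<le>4. continuous_on ({0..1} \<times> {0..T}) (\<lambda>(x, t). partial_x j u x t)) \<and>
     (\<forall>j\<le>2. continuous_on ({0..1} \<times> {0..T}) (\<lambda>(x, t). partial_t T j u x t))"

definition continuous_solution ::
    "real \<Rightarrow> (real \<Rightarrow> real) \<Rightarrow> (real \<Rightarrow> real \<Rightarrow> real) \<Rightarrow> bool" where
  "continuous_solution T u0 u \<longleftrightarrow>
     u0 0 = 0 \<and> u0 1 = 0 \<and>
     (\<forall>x\<in>{0<..1}. \<forall>t\<in>{0..T}.
        partial_t T 1 u x t =
          partial_x 2 u x t + 1 / x * partial_x 1 u x t - sin (2 * u x t) / (2 * x\<^sup>2)) \<and>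
     (\<forall>x\<in>{0..1}. u x 0 = u0 x) \<and>
     (\<forall>t\<in>{0..T}. u 0 t = 0 \<and> u 1 t = 0)"

definition Linf_norm :: "real \<Rightarrow> (real \<Rightarrow> real \<Rightarrow> real) \<Rightarrow> real" where
  "Linf_norm T f =
     real_of_ereal (esssup (lebesgue_on ({0..1} \<times> {0..T})) (\<lambda>(x, t). ereal \<bar>f x t\<bar>))"

section \<open>The discretization\<close>

definition mesh :: "nat \<Rightarrow> real" where
  "mesh N = 1 / (real N + 1)"

definition grid :: "nat \<Rightarrow> nat \<Rightarrow> real" where
  "grid N i = real i * mesh N"

text \<open>Vector and matrix indices start at \<open>0\<close>: component \<open>i < N\<close> belongs to the interior grid
  point \<open>grid N (Suc i)\<close>.\<close>

definition tridiag :: "nat \<Rightarrow> real \<Rightarrow> real \<Rightarrow> real \<Rightarrow> real mat" where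
  "tridiag N a b c = Matrix.mat N N (\<lambda>(i, j).
     if i = Suc j then a else if i = j then b else if j = Suc i then c else 0)"

definition A_mat :: "nat \<Rightarrow> real mat" where
  "A_mat N = (1 / (mesh N)\<^sup>2) \<cdot>\<^sub>m tridiag N (- 1) 2 (- 1)"

definition B_mat :: "nat \<Rightarrow> real mat" where
  "B_mat N = (1 / (2 * mesh N)) \<cdot>\<^sub>m tridiag N (- 1) 0 1"

definition D_powr :: "nat \<Rightarrow> real \<Rightarrow> real mat" where
  "D_powr N \<beta> = mat_diag N (\<lambda>i. grid N (Suc i) powr \<beta>)"

definition C_mat :: "nat \<Rightarrow> real mat" where
  "C_mat N = A_mat N - D_powr N (- 1) * B_mat N"

definition G_mat :: "nat \<Rightarrow> real vec \<Rightarrow> real mat" where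
  "G_mat N v = mat_diag N
     (\<lambda>i. if vec_index v i = 0 then 1 else sin (2 * vec_index v i) / (2 * vec_index v i))"

definition grid_vec :: "nat \<Rightarrow> (real \<Rightarrow> real) \<Rightarrow> real vec" where
  "grid_vec N f = Matrix.vec N (\<lambda>i. f (grid N (Suc i)))"

definition discrete_solution ::
    "real \<Rightarrow> (real \<Rightarrow> real) \<Rightarrow> nat \<Rightarrow> nat \<Rightarrow> (nat \<Rightarrow> real vec) \<Rightarrow> bool" where
  "discrete_solution T u0 N M U \<longleftrightarrow>
     (\<forall>n\<le>M. U n \<in> carrier_vec N) \<and>
     U 0 = grid_vec N u0 \<and>
     (\<forall>n<M. (1 / (T / real M)) \<cdot>\<^sub>v (U (Suc n) - U n) =
        - (C_mat N *\<^sub>v U (Suc n)) - (G_mat N (U n) * D_powr N (- 2)) *\<^sub>v U (Suc n))"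

definition max_norm :: "real vec \<Rightarrow> real" where
  "max_norm v = Max ((\<lambda>i. \<bar>vec_index v i\<bar>) ` {..<dim_vec v})"

definition norm_D :: "nat \<Rightarrow> real vec \<Rightarrow> real" where
  "norm_D N v = sqrt (mesh N * (\<Sum>i<N. grid N (Suc i) * (vec_index v i)\<^sup>2))"

end

theory Submission
  imports Defs "HOL-Probability.Sinc_Integral"
begin

text \<open>
  The error satisfies the scheme's own recursion, perturbed by the consistency residual \<open>\<rho>\<close>. The scheme
  obeys a maximum principle, so the iterates stay in \<open>[-c\<^sub>\<alpha>, c\<^sub>\<alpha>]\<close>, where \<open>sin (2y) / (2y) \<ge> \<alpha>\<^sup>2 > 1/4\<close>.
  Testing the error equation with the error itself in the weighted inner product, the operator
  \<open>C\<close> is positive semidefinite (it is a discretization of \<open>- x\<^sup>-\<^sup>1 (x w')'\<close>) and the zeroth-order term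
  controls \<open>h \<Sum> e\<^sub>i\<^sup>2 / (4 x\<^sub>i)\<close>. This Hardy-type term absorbs the test function, so that only
  \<open>x\<^sub>i \<rho>\<^sub>i\<close> has to be estimated. As \<open>\<bar>u\<bar> \<le> x \<parallel>u\<^sub>x\<parallel>\<close> and the truncation error of \<open>u\<^sub>x / x\<close> is
  \<open>O(h\<^sup>2 / x)\<close>, this weighted residual is \<open>O(\<Delta>t + h\<^sup>2 + \<bar>e\<bar>)\<close>, and a discrete Gronwall inequality
  concludes.
\<close>

section \<open>From the essential supremum to pointwise bounds\<close>

text \<open>The essential supremum ignores null sets, so continuity has to do the work: if
  \<open>\<bar>f\<bar>\<close> exceeded it at an interior point, it would do so on a nonempty open
  set, which is not negligible. Boundary points follow because the closed rectangle is the closure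
  of the open one.\<close>

lemma abs_le_Linf_norm:
  assumes "0 < T" and cont: "continuous_on ({0..1} \<times> {0..T}) (\<lambda>(x, t). f x t)"
    and x: "x \<in> {0..1}" and t: "t \<in> {0..T}"
  shows "\<bar>f x t\<bar> \<le> Linf_norm T f"
proof -
  let ?S = "{0..1::real} \<times> {0..T}" and ?I = "{0<..<1::real} \<times> {0<..<T}"
  define F where "F = (\<lambda>z. \<bar>f (fst z) (snd z)\<bar>)"
  let ?M = "lebesgue_on ?S"
  define L where "L = esssup ?M (\<lambda>z. ereal (F z))"
  have closed: "?S \<in> sets lebesgue"
    by (intro lmeasurable_compact fmeasurableD compact_Times compact_Icc)
  have contF: "continuous_on ?S F"
    using continuous_on_rabs[OF cont] by (simp add: F_def case_prod_unfold)
  have meas: "(\<lambda>z. ereal (F z)) \<in> borel_measurable ?M"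
    using continuous_imp_measurable_on_sets_lebesgue[OF contF closed] by simp
  obtain B where B: "\<And>z. z \<in> ?S \<Longrightarrow> F z \<le> B"
    using compact_continuous_image[OF contF compact_Times[OF compact_Icc compact_Icc]]
    by (metis (no_types, lifting) compact_imp_bounded bounded_imp_bdd_above bdd_above.E imageI)
  have "L \<le> ereal B"
    unfolding L_def by (rule esssup_I[OF meas]) (auto intro!: AE_I2 B)
  have bound: "\<forall>z\<in>?I. ereal (F z) \<le> L"
  proof (rule ccontr)
    assume "\<not> ?thesis"
    then obtain z where z: "z \<in> ?I" "L < ereal (F z)" by force
    then obtain b where b: "L < ereal b" "b < F z"
      by (metis ereal_dense2 less_ereal.simps(1))
    have sub: "?I \<subseteq> ?S" by auto
    define A where "A = {z \<in> ?I. b < F z}"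
    have "open A"
      unfolding A_def
      using continuous_on_open_vimage[of ?I F] continuous_on_subset[OF contF sub]
      by (auto simp: open_Times vimage_def Int_def conj_commute dest!: spec[of _ "{b<..}"])
    have "A \<subseteq> {z \<in> space ?M. ereal (F z) > L}"
      using sub b(1) by (auto simp: A_def intro: less_trans)
    moreover have "{z \<in> space ?M. ereal (F z) > L} \<in> null_sets ?M"
    proof (rule null_setsI)
      show "emeasure ?M {z \<in> space ?M. ereal (F z) > L} = 0"
        unfolding L_def by (rule esssup_zero_measure)
      have "{z \<in> space ?M. ereal (F z) > L} = (\<lambda>z. ereal (F z)) -` {L<..} \<inter> space ?M"
        by auto
      then show "{z \<in> space ?M. ereal (F z) > L} \<in> sets ?M"
        using measurable_sets[OF meas, of "{L<..}"] by simp
    qed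
    ultimately have "negligible A"
      using closed negligible_subset
      unfolding null_sets_restrict_space[OF closed] negligible_iff_null_sets by blast
    then have "A = {}" using \<open>open A\<close> open_not_negligible by blast
    then show False using z b by (auto simp: A_def)
  qed
  \<comment> \<open>With the upper bound \<open>B\<close>, the value at the centre makes
    \<open>L\<close> finite, so \<open>real_of_ereal\<close> returns the supremum itself and not its
    default 0.\<close>
  have "ereal (F (1/2, T/2)) \<le> L" using bound \<open>0 < T\<close> by auto
  then have "0 \<le> L" by (rule order_trans[rotated]) (simp add: F_def)
  with \<open>L \<le> ereal B\<close> obtain l where l: "L = ereal l" by (cases L) auto
  have cl: "closure ?I = ?S"
    using \<open>0 < T\<close> by (simp add: closure_Times)
  have "F (x, t) \<le> l"
    using continuous_le_on_closure[of ?I F "(x, t)" l] contF x t bound l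
    unfolding cl by auto
  moreover have "Linf_norm T f = l"
    using l by (simp add: Linf_norm_def L_def F_def case_prod_unfold)
  ultimately show ?thesis by (simp add: F_def)
qed

section \<open>The sinc function\<close>

lemma DERIV_sinc:
  fixes x :: real
  assumes "0 < x"
  shows "(sinc has_real_derivative (x * cos x - sin x) / x\<^sup>2) (at x)"
proof -
  have "((\<lambda>x. sin x / x) has_real_derivative (x * cos x - sin x) / x\<^sup>2) (at x)"
    using assms by (auto intro!: derivative_eq_intros simp: power2_eq_square field_simps)
  then show ?thesis
    by (rule has_field_derivative_transform_within_open[where S = "{0<..}"]) (use assms in auto)
qed

text \<open>The expression is the numerator of the derivative of \<open>sinc\<close>; the cosine
  terms cancel in its own derivative, which is \<open>- (x * sin x)\<close>.\<close>

lemma x_cos_minus_sin_MVT: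
  fixes x :: real
  assumes "0 < x"
  obtains z where "0 < z" "z < x" "x * cos x - sin x = - (x * (z * sin z))"
proof -
  have "\<exists>z>0. z < x \<and> (x * cos x - sin x) - (0 * cos 0 - sin 0) = (x - 0) * (- (z * sin z))"
    using assms by (intro MVT2) (auto intro!: derivative_eq_intros)
  then show ?thesis using that by auto
qed

text \<open>Two nested mean value steps, one for \<open>sinc\<close> and one for the numerator of
  its derivative. In the form \<open>y * sin y / z\<close> with \<open>0 < y < z\<close>, the sign
  of the slope (up to \<open>pi\<close>) and the bound 1 on its modulus can be read off.\<close>

lemma sinc_MVT:
  assumes "0 \<le> a" "a < b"
  obtains y z where "0 < y" "y < z" "z < b" "sinc b - sinc a = (b - a) * - (y * sin y / z)"
proof -
  \<comment> \<open>For \<open>a = 0\<close> the formula for the derivative is only at hand in the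
    open interval; continuity covers the end point.\<close>
  have "sinc differentiable (at x)" if "a < x" for x
    using DERIV_sinc[of x] that \<open>0 \<le> a\<close> real_differentiable_def by force
  moreover have "continuous_on {a..b} sinc"
    using isCont_sinc by (intro continuous_at_imp_continuous_on ballI)
  ultimately obtain l z where l: "a < z" "z < b" "(sinc has_real_derivative l) (at z)"
    "sinc b - sinc a = (b - a) * l"
    using MVT[OF \<open>a < b\<close>, of sinc] by blast
  have "0 < z" using l assms by simp
  then have l_eq: "l = (z * cos z - sin z) / z\<^sup>2"
    using l(3) DERIV_sinc DERIV_unique by blast
  obtain y where y: "0 < y" "y < z" "z * cos z - sin z = - (z * (y * sin y))"
    using x_cos_minus_sin_MVT[OF \<open>0 < z\<close>] .
  have "l = - (y * sin y / z)"
    unfolding l_eq y(3) using \<open>0 < z\<close> by (simp add: power2_eq_square)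
  then show ?thesis using that[of y z] y l by simp
qed

lemma sinc_antimono:
  assumes "0 \<le> a" "a \<le> b" "b \<le> pi"
  shows "sinc b \<le> sinc a"
proof (cases "a = b")
  case False
  then have "a < b" using assms by simp
  obtain y z where yz: "0 < y" "y < z" "z < b"
    and eq: "sinc b - sinc a = (b - a) * - (y * sin y / z)"
    using sinc_MVT[OF \<open>0 \<le> a\<close> \<open>a < b\<close>] .
  have "0 \<le> sin y" using yz assms by (intro sin_ge_zero) auto
  then have "0 \<le> (b - a) * (y * sin y / z)"
    using yz \<open>a < b\<close> by (intro mult_nonneg_nonneg divide_nonneg_nonneg) auto
  then show ?thesis using eq by linarith
qed simp

lemma sinc_Lipschitz: "\<bar>sinc a - sinc b\<bar> \<le> \<bar>a - b\<bar>"
proof -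
  have nonneg: "\<bar>sinc b - sinc a\<bar> \<le> b - a" if "0 \<le> a" "a < b" for a b :: real
  proof -
    obtain y z where yz: "0 < y" "y < z" "z < b"
      and eq: "sinc b - sinc a = (b - a) * - (y * sin y / z)"
      using sinc_MVT[OF \<open>0 \<le> a\<close> \<open>a < b\<close>] .
    have "\<bar>y * sin y\<bar> \<le> z * 1"
      unfolding abs_mult using yz by (intro mult_mono) auto
    then have "\<bar>y * sin y / z\<bar> \<le> 1"
      using yz by simp
    have "\<bar>sinc b - sinc a\<bar> = (b - a) * \<bar>y * sin y / z\<bar>"
      unfolding eq abs_mult abs_minus_cancel using that by simp
    also have "\<dots> \<le> (b - a) * 1"
      using \<open>\<bar>y * sin y / z\<bar> \<le> 1\<close> that by (intro mult_left_mono) auto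
    finally show ?thesis unfolding mult_1_right .
  qed
  \<comment> \<open>\<open>sinc\<close> is even, so both arguments may be replaced by their moduli,
    whose distance is at most \<open>\<bar>a - b\<bar>\<close>.\<close>
  have abs_eq: "sinc \<bar>x\<bar> = sinc x" for x :: real
    by (simp add: abs_if)
  have "\<bar>sinc \<bar>a\<bar> - sinc \<bar>b\<bar>\<bar> \<le> \<bar>\<bar>a\<bar> - \<bar>b\<bar>\<bar>"
  proof (cases "\<bar>a\<bar>" "\<bar>b\<bar>" rule: linorder_cases)
    case less
    show ?thesis using nonneg[OF abs_ge_zero less] by linarith
  next
    case equal
    then show ?thesis by simp
  next
    case greater
    show ?thesis using nonneg[OF abs_ge_zero greater] by linarith
  qed
  then show ?thesis unfolding abs_eq by linarith
qed

section \<open>The discrete operator\<close>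

text \<open>A row of \<open>C_mat\<close> acting on a grid function that also has values at the
  boundary indices 0 and \<open>Suc N\<close>. Indices are those of the grid points, one more than
  the vector indices.\<close>

definition stencil :: "nat \<Rightarrow> (nat \<Rightarrow> real) \<Rightarrow> nat \<Rightarrow> real" where
  "stencil N w i = (2 * w i - w (i - 1) - w (i + 1)) / (mesh N)\<^sup>2
     - (w (i + 1) - w (i - 1)) / (2 * mesh N * grid N i)"

text \<open>Moves a vector to grid indices and adds the homogeneous boundary values, so that the
  first and last matrix rows are no exceptions.\<close>

definition zero_ext :: "nat \<Rightarrow> real vec \<Rightarrow> nat \<Rightarrow> real" where
  "zero_ext N v i = (if 1 \<le> i \<and> i \<le> N then vec_index v (i - 1) else 0)"

lemma mesh_pos: "0 < mesh N"
  by (simp add: mesh_def)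

lemma grid_pos: "1 \<le> i \<Longrightarrow> 0 < grid N i"
  by (simp add: grid_def mesh_pos)

text \<open>Multiplication by the radius gives the flux form of \<open>- (x w')'\<close>, with the
  weights taken at the midpoints between grid points. Their positivity drives both the maximum
  principle and the coercivity.\<close>

lemma stencil_conservative:
  assumes "1 \<le> i"
  shows "(mesh N)\<^sup>2 * (real i * stencil N w i) =
    (real i - 1/2) * (w i - w (i - 1)) + (real i + 1/2) * (w i - w (i + 1))"
  using assms mesh_pos[of N]
  by (simp add: stencil_def grid_def field_simps power2_eq_square)

text \<open>Row \<open>k\<close> belongs to grid index \<open>k + 1\<close>, so its neighbours are
  \<open>k\<close> and \<open>k + 2\<close>; the zeros of \<open>zero_ext\<close> replace the
  entries missing in the outer rows.\<close>

lemma tridiag_mult_vec: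
  assumes v: "v \<in> carrier_vec N" and "k < N"
  shows "vec_index (tridiag N a b c *\<^sub>v v) k =
    a * zero_ext N v k + b * zero_ext N v (k + 1) + c * zero_ext N v (k + 2)"
proof -
  have "vec_index (tridiag N a b c *\<^sub>v v) k = (\<Sum>j<N.
      (if k = Suc j then a * vec_index v j else 0) + (if k = j then b * vec_index v j else 0)
      + (if j = Suc k then c * vec_index v j else 0))"
    using assms by (simp add: tridiag_def scalar_prod_def atLeast0LessThan)
      (intro sum.cong, auto)
  also have "\<dots> = (\<Sum>j<N. if k = Suc j then a * vec_index v j else 0)
      + (\<Sum>j<N. if k = j then b * vec_index v j else 0)
      + (\<Sum>j<N. if j = Suc k then c * vec_index v j else 0)"
    by (simp add: sum.distrib)
  also have "(\<Sum>j<N. if k = Suc j then a * vec_index v j else 0) = a * zero_ext N v k"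
    using \<open>k < N\<close> by (cases k) (auto simp: zero_ext_def)
  also have "(\<Sum>j<N. if k = j then b * vec_index v j else 0) = b * zero_ext N v (k + 1)"
    using \<open>k < N\<close> by (auto simp: zero_ext_def)
  also have "(\<Sum>j<N. if j = Suc k then c * vec_index v j else 0) = c * zero_ext N v (k + 2)"
    by (auto simp: zero_ext_def)
  finally show ?thesis .
qed

lemma mat_diag_mult_vec:
  assumes "dim_vec v = N" "k < N"
  shows "vec_index (mat_diag N f *\<^sub>v v) k = f k * vec_index v k"
  using assms by (simp add: mat_diag_def scalar_prod_def atLeast0LessThan
      if_distrib[of "\<lambda>x. x * _"] cong: if_cong)

lemma C_mat_mult_vec:
  assumes v: "v \<in> carrier_vec N" and k: "k < N"
  shows "vec_index (C_mat N *\<^sub>v v) k = stencil N (zero_ext N v) (k + 1)"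
proof -
  have car: "tridiag N a b c \<in> carrier_mat N N" for a b c
    by (simp add: tridiag_def)
  have carA: "A_mat N \<in> carrier_mat N N" and carB: "B_mat N \<in> carrier_mat N N"
    using car by (auto simp: A_mat_def B_mat_def)
  have carD: "D_powr N \<beta> \<in> carrier_mat N N" for \<beta>
    by (simp add: D_powr_def)
  have "C_mat N *\<^sub>v v = A_mat N *\<^sub>v v - (D_powr N (- 1) * B_mat N) *\<^sub>v v"
    unfolding C_mat_def using v carA carB carD[of "-1"]
    by (intro minus_mult_distrib_mat_vec) auto
  also have "(D_powr N (- 1) * B_mat N) *\<^sub>v v = D_powr N (- 1) *\<^sub>v (B_mat N *\<^sub>v v)"
    using carD carB v by (rule assoc_mult_mat_vec)
  finally have "vec_index (C_mat N *\<^sub>v v) k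
      = vec_index (A_mat N *\<^sub>v v) k - grid N (Suc k) powr (- 1) * vec_index (B_mat N *\<^sub>v v) k"
    using k v carA carB carD mat_diag_mult_vec[of "B_mat N *\<^sub>v v" N k "\<lambda>i. grid N (Suc i) powr (- 1)"]
    by (simp add: D_powr_def carrier_matD(1)[OF mat_diag_dim])
  moreover have "vec_index (A_mat N *\<^sub>v v) k = 1 / (mesh N)\<^sup>2 * vec_index (tridiag N (- 1) 2 (- 1) *\<^sub>v v) k"
    using k v car[of "-1" 2 "-1"] by (simp add: A_mat_def carrier_matD[OF car])
  moreover have "vec_index (B_mat N *\<^sub>v v) k = 1 / (2 * mesh N) * vec_index (tridiag N (- 1) 0 1 *\<^sub>v v) k"
    using k v car[of "-1" 0 1] by (simp add: B_mat_def carrier_matD[OF car])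
  ultimately show ?thesis
    using grid_pos[of "Suc k" N]
    by (simp add: tridiag_mult_vec[OF v k] stencil_def powr_minus divide_simps)
qed

text \<open>The case distinction in \<open>G_mat\<close> is the one in the definition of
  \<open>sinc\<close>, so the lagged nonlinearity becomes \<open>sinc (2 * w i)\<close>, zeros of
  \<open>w\<close> included.\<close>

lemma discrete_solution_pointwise:
  assumes sol: "discrete_solution T u0 N M U" and n: "n < M" and i: "1 \<le> i" "i \<le> N"
    and "0 < T"
  defines "w \<equiv> zero_ext N (U n)" and "w' \<equiv> zero_ext N (U (Suc n))"
  shows "(w' i - w i) / (T / real M) =
    - stencil N w' i - sinc (2 * w i) * w' i / (grid N i)\<^sup>2"
proof -
  obtain k where k: "i = Suc k" "k < N" using i by (cases i) auto
  have car: "U n \<in> carrier_vec N" "U (Suc n) \<in> carrier_vec N"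
    using sol n by (auto simp: discrete_solution_def)
  have carC: "C_mat N \<in> carrier_mat N N"
    unfolding C_mat_def D_powr_def B_mat_def A_mat_def tridiag_def mat_diag_def
    by (intro minus_carrier_mat mult_carrier_mat[of _ _ N] smult_carrier_mat mat_carrier)
  have GD: "(G_mat N (U n) * D_powr N (- 2)) *\<^sub>v U (Suc n)
      = G_mat N (U n) *\<^sub>v (D_powr N (- 2) *\<^sub>v U (Suc n))"
    using car by (intro assoc_mult_mat_vec[of _ N N _ N]) (auto simp: G_mat_def D_powr_def)
  have "vec_index ((1 / (T / real M)) \<cdot>\<^sub>v (U (Suc n) - U n)) k =
      vec_index (- (C_mat N *\<^sub>v U (Suc n)) - (G_mat N (U n) * D_powr N (- 2)) *\<^sub>v U (Suc n)) k"
    using sol n by (simp add: discrete_solution_def)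
  also have "\<dots> = - stencil N w' i - sinc (2 * w i) * (grid N i powr (- 2) * w' i)"
  proof -
    have "vec_index (C_mat N *\<^sub>v U (Suc n)) k = stencil N w' i"
      using C_mat_mult_vec[OF car(2) k(2)] k(1) by (simp add: w'_def)
    moreover have "vec_index (G_mat N (U n) *\<^sub>v (D_powr N (- 2) *\<^sub>v U (Suc n))) k
        = sinc (2 * w i) * (grid N i powr (- 2) * w' i)"
      using car k unfolding G_mat_def D_powr_def
      by (subst mat_diag_mult_vec, simp add: carrier_matD[OF mat_diag_dim], simp,
          subst mat_diag_mult_vec) (simp_all add: w_def w'_def zero_ext_def)
    ultimately show ?thesis
      unfolding GD using car carC k
      by (simp add: carrier_matD(1)[OF mat_diag_dim] G_mat_def del: index_mult_mat_vec)
  qed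
  also have "grid N i powr (- 2) = 1 / (grid N i)\<^sup>2"
    using grid_pos[OF i(1), of N] by (simp add: powr_minus powr_numeral divide_simps)
  finally have "vec_index ((1 / (T / real M)) \<cdot>\<^sub>v (U (Suc n) - U n)) k
      = - stencil N w' i - sinc (2 * w i) * (1 / (grid N i)\<^sup>2 * w' i)" .
  moreover have "vec_index ((1 / (T / real M)) \<cdot>\<^sub>v (U (Suc n) - U n)) k = (w' i - w i) / (T / real M)"
    using car k by (simp add: w_def w'_def zero_ext_def)
  ultimately show ?thesis by simp
qed

section \<open>Stability\<close>

text \<open>At an index where \<open>\<bar>w'\<bar>\<close> is largest, \<open>w'\<close> times each
  flux difference is nonnegative. Multiplying the equation by \<open>w'\<close> there leaves
  \<open>(w' m)\<^sup>2 \<le> w' m * w m\<close>, for every step size \<open>k\<close>, as the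
  scheme is implicit.\<close>

lemma stencil_max_principle:
  assumes eq: "\<And>i. \<lbrakk>1 \<le> i; i \<le> N\<rbrakk> \<Longrightarrow> (w' i - w i) / k = - stencil N w' i - q i * w' i"
    and "0 < k" and q: "\<And>i. \<lbrakk>1 \<le> i; i \<le> N\<rbrakk> \<Longrightarrow> 0 \<le> q i"
    and bd: "w' 0 = 0" "w' (Suc N) = 0"
    and w: "\<And>i. \<lbrakk>1 \<le> i; i \<le> N\<rbrakk> \<Longrightarrow> \<bar>w i\<bar> \<le> c" and "0 \<le> c"
    and "i \<le> Suc N"
  shows "\<bar>w' i\<bar> \<le> c"
proof -
  have "Max ((\<lambda>j. \<bar>w' j\<bar>) ` {..Suc N}) \<in> (\<lambda>j. \<bar>w' j\<bar>) ` {..Suc N}"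
    by (rule Max_in) auto
  then obtain m where "m \<le> Suc N" and Max: "Max ((\<lambda>j. \<bar>w' j\<bar>) ` {..Suc N}) = \<bar>w' m\<bar>"
    by (metis (no_types, lifting) atMost_iff imageE)
  have m: "m \<le> Suc N" "\<And>j. j \<le> Suc N \<Longrightarrow> \<bar>w' j\<bar> \<le> \<bar>w' m\<bar>"
    unfolding Max[symmetric] using \<open>m \<le> Suc N\<close> by (auto intro!: Max_ge)
  have "\<bar>w' m\<bar> \<le> c"
  proof (cases "1 \<le> m \<and> m \<le> N")
    case True
    have nb: "0 \<le> w' m * (w' m - w' j)" if "j \<le> Suc N" for j
    proof -
      have "w' m * w' j \<le> \<bar>w' m\<bar> * \<bar>w' j\<bar>" by (metis abs_ge_self abs_mult)
      also have "\<dots> \<le> \<bar>w' m\<bar> * \<bar>w' m\<bar>" using m(2)[OF that] by (intro mult_left_mono) auto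
      finally show ?thesis by (simp add: algebra_simps)
    qed
    have pos: "0 < (mesh N)\<^sup>2 * real m" using True mesh_pos[of N] by simp
    have "(mesh N)\<^sup>2 * real m * (w' m * stencil N w' m)
        = w' m * ((mesh N)\<^sup>2 * (real m * stencil N w' m))"
      by (simp add: mult_ac)
    also have "\<dots> = (real m - 1/2) * (w' m * (w' m - w' (m - 1))) + (real m + 1/2) * (w' m * (w' m - w' (m + 1)))"
      using stencil_conservative[of m N w'] True by (simp add: distrib_left mult.left_commute)
    also have "\<dots> \<ge> 0"
      using True by (intro add_nonneg_nonneg mult_nonneg_nonneg[of "_ - 1/2"] mult_nonneg_nonneg[of "_ + 1/2"] nb) auto
    finally have "0 \<le> w' m * stencil N w' m"
      using pos by (meson linorder_not_le mult_pos_neg)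
    \<comment> \<open>The equation at \<open>m\<close>, tested with \<open>w' m\<close>; both terms
      in the bracket are nonnegative.\<close>
    moreover have "w' m * (w' m - w m) = - k * (w' m * stencil N w' m + q m * (w' m)\<^sup>2)"
    proof -
      have "w' m - w m = - k * (stencil N w' m + q m * w' m)"
        using eq[of m] True \<open>0 < k\<close> by (simp add: field_simps)
      then show ?thesis by (simp only:) (simp add: algebra_simps power2_eq_square)
    qed
    ultimately have "w' m * (w' m - w m) \<le> 0"
      using \<open>0 < k\<close> q[of m] True by (simp add: mult_le_0_iff zero_le_mult_iff add_nonneg_nonneg)
    then have "\<bar>w' m\<bar> * \<bar>w' m\<bar> \<le> w' m * w m" by (simp add: algebra_simps)
    also have "\<dots> \<le> \<bar>w' m\<bar> * \<bar>w m\<bar>" by (metis abs_ge_self abs_mult)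
    finally have "\<bar>w' m\<bar> \<le> \<bar>w m\<bar>"
      by (cases "w' m = 0") (simp, metis mult_le_cancel_left_pos zero_less_abs_iff)
    then show ?thesis using w[of m] True by simp
  next
    case False
    then have "m = 0 \<or> m = Suc N" using m by auto
    then show ?thesis using bd \<open>0 \<le> c\<close> by auto
  qed
  then show ?thesis using m(2)[OF \<open>i \<le> Suc N\<close>] by simp
qed

text \<open>Positive semidefiniteness of \<open>C_mat\<close> in the weighted inner product, a
  consequence of the flux form.\<close>

lemma stencil_coercive:
  assumes "w 0 = 0" "w (Suc N) = 0"
  shows "0 \<le> (\<Sum>i=1..N. grid N i * (w i * stencil N w i))"
proof -
  define s where "s i = w i * ((real i - 1/2) * (w i - w (i - 1)) + (real i + 1/2) * (w i - w (i + 1)))" for i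
  \<comment> \<open>Summation by parts: the boundary term remains, the dropped terms are squares.\<close>
  have partial: "(real m + 1/2) * (w m * (w m - w (m + 1))) \<le> (\<Sum>i=1..m. s i)" for m
  proof (induction m)
    case 0
    then show ?case using assms by simp
  next
    case (Suc m)
    have "(real (Suc m) + 1/2) * (w (Suc m) * (w (Suc m) - w (Suc m + 1)))
       = s (Suc m) - (real m + 1/2) * (w (Suc m) * (w (Suc m) - w m))"
      by (simp add: s_def algebra_simps)
    also have "\<dots> = s (Suc m) + (real m + 1/2) * (w m * (w m - w (m + 1)))
        - (real m + 1/2) * (w (Suc m) - w m)\<^sup>2"
      by (simp add: algebra_simps power2_eq_square)
    also have "\<dots> \<le> s (Suc m) + (\<Sum>i=1..m. s i)"
    proof -
      have "0 \<le> (real m + 1/2) * (w (Suc m) - w m)\<^sup>2" by simp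
      then show ?thesis using Suc.IH by linarith
    qed
    finally show ?case by simp
  qed
  \<comment> \<open>As \<open>w\<close> vanishes at \<open>N + 1\<close>, the remaining boundary
    term is a multiple of \<open>(w N)\<^sup>2\<close>.\<close>
  have "0 \<le> (real N + 1/2) * (w N * (w N - w (N + 1)))"
    using assms by simp
  also have "\<dots> \<le> (\<Sum>i=1..N. s i)" by (rule partial)
  also have "\<dots> = (\<Sum>i=1..N. mesh N * (grid N i * (w i * stencil N w i)))"
  proof (rule sum.cong[OF refl])
    fix i assume "i \<in> {1..N}"
    then show "s i = mesh N * (grid N i * (w i * stencil N w i))"
      unfolding s_def using stencil_conservative[of i N w, symmetric]
      by (simp add: grid_def power2_eq_square mult_ac)
  qed
  finally show ?thesis
    using mesh_pos[of N] by (simp add: sum_distrib_left[symmetric] zero_le_mult_iff)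
qed

text \<open>Bounds the squared weighted norm of the constant 1, and thus the contribution of a
  uniform residual bound to the energy.\<close>

lemma mesh_sum_grid_le_1: "mesh N * (\<Sum>i=1..N. grid N i) \<le> 1"
proof -
  have "(\<Sum>i=1..N. grid N i) \<le> (\<Sum>i=1..N. 1)"
    by (intro sum_mono) (auto simp: grid_def mesh_def divide_simps)
  then have "mesh N * (\<Sum>i=1..N. grid N i) \<le> mesh N * real N"
    using mesh_pos[of N] by (intro mult_left_mono) auto
  then show ?thesis by (simp add: mesh_def divide_simps split: if_splits)
qed

section \<open>Energy estimate and discrete Gronwall inequality\<close>

definition energy :: "nat \<Rightarrow> (nat \<Rightarrow> real) \<Rightarrow> real" where
  "energy N w = mesh N * (\<Sum>i=1..N. grid N i * (w i)\<^sup>2)"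

text \<open>The equation is tested with \<open>grid N i * e' i\<close>. The reaction term provides
  \<open>(e' i)\<^sup>2 / (4 * x)\<close>, exactly what Young's inequality needs to absorb the test
  function, and the stencil is dropped by coercivity. The residual bound involves only the old error
  \<open>e\<close>, so no smallness of \<open>k\<close> is required.\<close>

lemma energy_step:
  assumes eq: "\<And>i. \<lbrakk>1 \<le> i; i \<le> N\<rbrakk> \<Longrightarrow>
      (e' i - e i) / k + stencil N e' i + g i * e' i / (grid N i)\<^sup>2 = \<rho> i"
    and "0 < k" and g: "\<And>i. \<lbrakk>1 \<le> i; i \<le> N\<rbrakk> \<Longrightarrow> 1/4 \<le> g i"
    and bd: "e' 0 = 0" "e' (Suc N) = 0"
    and \<rho>: "\<And>i. \<lbrakk>1 \<le> i; i \<le> N\<rbrakk> \<Longrightarrow> grid N i * \<bar>\<rho> i\<bar> \<le> E + K * \<bar>e i\<bar>"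
  shows "energy N e' \<le> (1 + 4 * k * K\<^sup>2) * energy N e + 4 * k * E\<^sup>2"
proof -
  have pt: "grid N i * (e' i)\<^sup>2 \<le> (1 + 4 * k * K\<^sup>2) * (grid N i * (e i)\<^sup>2)
      + 4 * k * E\<^sup>2 * grid N i - 2 * k * (grid N i * (e' i * stencil N e' i))"
    if i: "1 \<le> i" "i \<le> N" for i
  proof -
    define x where "x = grid N i"
    define r where "r = x * \<rho> i"
    have "0 < x" using grid_pos i by (simp add: x_def)
    have "\<bar>r\<bar> \<le> E + K * \<bar>e i\<bar>"
      using \<rho>[OF i] \<open>0 < x\<close> by (simp add: r_def x_def abs_mult)
    then have "r\<^sup>2 \<le> (E + K * \<bar>e i\<bar>)\<^sup>2" by (rule abs_le_square_iff[THEN iffD1, OF order_trans[OF _ abs_ge_self]])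
    also have "\<dots> \<le> 2 * E\<^sup>2 + 2 * K\<^sup>2 * (e i)\<^sup>2"
      using sum_squares_bound[of E "K * \<bar>e i\<bar>"] by (simp add: power2_sum power_mult_distrib)
    finally have r2: "r\<^sup>2 \<le> 2 * E\<^sup>2 + 2 * K\<^sup>2 * (e i)\<^sup>2" .
    have "x * (e' i * (e' i - e i)) / k + x * (e' i * stencil N e' i) + g i * ((e' i)\<^sup>2 / x)
        = x * e' i * ((e' i - e i) / k + stencil N e' i + g i * e' i / x\<^sup>2)"
      using \<open>0 < x\<close> by (simp add: algebra_simps power2_eq_square)
    also have "\<dots> = r * e' i"
      using eq[OF i] by (simp add: r_def x_def)
    \<comment> \<open>Young's inequality, weighted so that its second term matches the lower bound
      \<open>1/4\<close> of \<open>g\<close>.\<close>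
    also have "\<dots> \<le> x * r\<^sup>2 + (e' i)\<^sup>2 / (4 * x)"
    proof -
      have "0 \<le> (2 * x * r - e' i)\<^sup>2 / (4 * x)" using \<open>0 < x\<close> by simp
      also have "\<dots> = x * r\<^sup>2 + (e' i)\<^sup>2 / (4 * x) - r * e' i"
        using \<open>0 < x\<close> by (simp add: field_simps power2_eq_square)
      finally show ?thesis by simp
    qed
    also have "(e' i)\<^sup>2 / (4 * x) \<le> g i * ((e' i)\<^sup>2 / x)"
      using mult_right_mono[OF g[OF i], of "(e' i)\<^sup>2 / x"] \<open>0 < x\<close> by simp
    finally have "x * (e' i * (e' i - e i)) / k + x * (e' i * stencil N e' i) \<le> x * r\<^sup>2" by simp
    also have "\<dots> \<le> x * (2 * E\<^sup>2 + 2 * K\<^sup>2 * (e i)\<^sup>2)"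
      using r2 \<open>0 < x\<close> by (intro mult_left_mono) auto
    finally have "x * (e' i * (e' i - e i)) \<le>
        k * (x * (2 * E\<^sup>2 + 2 * K\<^sup>2 * (e i)\<^sup>2) - x * (e' i * stencil N e' i))"
      using \<open>0 < k\<close> by (simp add: field_simps)
    \<comment> \<open>The difference of the two sides is \<open>x * (e' i - e i)\<^sup>2\<close>,
      the numerical dissipation of the implicit step.\<close>
    moreover have "x * ((e' i)\<^sup>2 - (e i)\<^sup>2) \<le> x * (2 * (e' i * (e' i - e i)))"
      using \<open>0 < x\<close> sum_squares_bound[of "e' i" "e i"]
      by (intro mult_left_mono) (auto simp: algebra_simps power2_eq_square)
    ultimately show ?thesis
      unfolding x_def[symmetric] by (simp add: algebra_simps)
  qed
  have "(\<Sum>i=1..N. grid N i * (e' i)\<^sup>2) \<le> (\<Sum>i=1..N. (1 + 4 * k * K\<^sup>2) * (grid N i * (e i)\<^sup>2)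
      + 4 * k * E\<^sup>2 * grid N i - 2 * k * (grid N i * (e' i * stencil N e' i)))"
    by (intro sum_mono pt) auto
  also have "\<dots> = (1 + 4 * k * K\<^sup>2) * (\<Sum>i=1..N. grid N i * (e i)\<^sup>2)
      + 4 * k * E\<^sup>2 * (\<Sum>i=1..N. grid N i) - 2 * k * (\<Sum>i=1..N. grid N i * (e' i * stencil N e' i))"
    by (simp add: sum.distrib sum_subtractf sum_distrib_left)
  also have "\<dots> \<le> (1 + 4 * k * K\<^sup>2) * (\<Sum>i=1..N. grid N i * (e i)\<^sup>2) + 4 * k * E\<^sup>2 * (\<Sum>i=1..N. grid N i)"
    using stencil_coercive[of e' N, OF bd] \<open>0 < k\<close> by simp
  finally have "energy N e' \<le> mesh N * ((1 + 4 * k * K\<^sup>2) * (\<Sum>i=1..N. grid N i * (e i)\<^sup>2)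
      + 4 * k * E\<^sup>2 * (\<Sum>i=1..N. grid N i))"
    unfolding energy_def using mesh_pos[of N] by (intro mult_left_mono) auto
  also have "\<dots> = (1 + 4 * k * K\<^sup>2) * energy N e + 4 * k * E\<^sup>2 * (mesh N * (\<Sum>i=1..N. grid N i))"
    by (simp add: energy_def algebra_simps)
  also have "\<dots> \<le> (1 + 4 * k * K\<^sup>2) * energy N e + 4 * k * E\<^sup>2 * 1"
    using mesh_sum_grid_le_1[of N] \<open>0 < k\<close> by (intro add_left_mono mult_left_mono) auto
  finally show ?thesis by simp
qed

text \<open>The factor \<open>real n * q\<close> in place of the geometric sum avoids a division by
  \<open>p\<close>, which may be 0.\<close>

lemma discrete_Gronwall:
  fixes a :: "nat \<Rightarrow> real"
  assumes "a 0 = 0" and step: "\<And>n. n < M \<Longrightarrow> a (Suc n) \<le> (1 + p) * a n + q"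
    and "0 \<le> p" "0 \<le> q" "n \<le> M"
  shows "a n \<le> real n * q * exp (p * real n)"
proof -
  have "a n \<le> real n * q * (1 + p) ^ n" using \<open>n \<le> M\<close>
  proof (induction n)
    case 0
    then show ?case using assms by simp
  next
    case (Suc n)
    have "a (Suc n) \<le> (1 + p) * a n + q" using step Suc by simp
    also have "\<dots> \<le> (1 + p) * (real n * q * (1 + p) ^ n) + q"
      using Suc \<open>0 \<le> p\<close> by (intro add_right_mono mult_left_mono) auto
    also have "\<dots> \<le> (1 + p) * (real n * q * (1 + p) ^ n) + q * (1 + p) ^ Suc n"
      using \<open>0 \<le> p\<close> \<open>0 \<le> q\<close> one_le_power[of "1 + p" "Suc n"] mult_left_mono[of 1 "(1 + p) ^ Suc n" q]
      by simp
    finally show ?case by (simp add: algebra_simps)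
  qed
  also have "(1 + p) ^ n \<le> exp p ^ n"
    using \<open>0 \<le> p\<close> by (intro power_mono) auto
  also have "exp p ^ n = exp (p * real n)"
    by (simp add: exp_of_nat_mult[symmetric] mult.commute)
  finally show ?thesis using \<open>0 \<le> q\<close> by (simp add: mult_left_mono)
qed

section \<open>Consistency\<close>

text \<open>Taylor expansion about \<open>x\<close> at both neighbours: odd terms cancel in the
  second difference, even ones in the central first difference. Derivatives are relative to the
  closed interval, so a neighbour may be an end point.\<close>

lemma difference_quotient_errors:
  fixes g :: "nat \<Rightarrow> real \<Rightarrow> real"
  assumes der: "\<And>j x. \<lbrakk>j < 4; x \<in> {0..1}\<rbrakk> \<Longrightarrow>
      (g j has_real_derivative g (Suc j) x) (at x within {0..1})"
    and K3: "\<And>x. x \<in> {0..1} \<Longrightarrow> \<bar>g 3 x\<bar> \<le> K3"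
    and K4: "\<And>x. x \<in> {0..1} \<Longrightarrow> \<bar>g 4 x\<bar> \<le> K4"
    and h: "0 < h" "0 \<le> x - h" "x + h \<le> 1"
  shows "\<bar>(2 * g 0 x - g 0 (x - h) - g 0 (x + h)) / h\<^sup>2 + g 2 x\<bar> \<le> K4 * h\<^sup>2"
    and "\<bar>(g 0 (x + h) - g 0 (x - h)) / (2 * h) - g 1 x\<bar> \<le> K3 * h\<^sup>2"
proof -
  have x: "x \<in> {0..1}" and z: "x + h \<in> {0..1}" "x - h \<in> {0..1}" using h by auto
  \<comment> \<open>\<open>field_Taylor\<close> divides the remainder by \<open>fact n\<close>, here
    6 and below 2; these cruder constants suffice.\<close>
  have T3: "\<bar>g 0 z - (g 0 x + g 1 x * (z - x) + g 2 x * (z - x)\<^sup>2 / 2 + g 3 x * (z - x) ^ 3 / 6)\<bar>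
      \<le> K4 * \<bar>z - x\<bar> ^ 4 / 6" if "z \<in> {0..1}" for z
    using field_Taylor[of "{0..1}" 3 g K4 x z] der K4 x that
    by (simp add: eval_nat_numeral)
  have T2: "\<bar>g 0 z - (g 0 x + g 1 x * (z - x) + g 2 x * (z - x)\<^sup>2 / 2)\<bar>
      \<le> K3 * \<bar>z - x\<bar> ^ 3 / 2" if "z \<in> {0..1}" for z
    using field_Taylor[of "{0..1}" 2 g K3 x z] der K3 x that
    by (simp add: eval_nat_numeral)
  have "0 \<le> K3" "0 \<le> K4" using K3[OF x] K4[OF x] by auto
  have "\<bar>(2 * g 0 x - g 0 (x - h) - g 0 (x + h)) + h\<^sup>2 * g 2 x\<bar> \<le> K4 * h ^ 4 / 6 + K4 * h ^ 4 / 6"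
  proof -
    have "\<bar>g 0 (x + h) - (g 0 x + g 1 x * h + g 2 x * h\<^sup>2 / 2 + g 3 x * h ^ 3 / 6)\<bar> \<le> K4 * h ^ 4 / 6"
      using T3[OF z(1)] h by simp
    moreover have "\<bar>g 0 (x - h) - (g 0 x - g 1 x * h + g 2 x * h\<^sup>2 / 2 - g 3 x * h ^ 3 / 6)\<bar> \<le> K4 * h ^ 4 / 6"
      using T3[OF z(2)] h by simp
    ultimately show ?thesis
      unfolding abs_le_iff mult.commute[of "h\<^sup>2" "g 2 x"] by linarith
  qed
  also have "\<dots> \<le> h\<^sup>2 * (K4 * h\<^sup>2)"
    using \<open>0 \<le> K4\<close> h by (simp add: eval_nat_numeral)
  finally have "\<bar>(2 * g 0 x - g 0 (x - h) - g 0 (x + h)) + h\<^sup>2 * g 2 x\<bar> / h\<^sup>2 \<le> K4 * h\<^sup>2"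
    using h by (simp add: divide_le_eq mult.commute)
  moreover have "\<bar>(2 * g 0 x - g 0 (x - h) - g 0 (x + h)) + h\<^sup>2 * g 2 x\<bar> / h\<^sup>2
      = \<bar>(2 * g 0 x - g 0 (x - h) - g 0 (x + h)) / h\<^sup>2 + g 2 x\<bar>"
  proof -
    have "(2 * g 0 x - g 0 (x - h) - g 0 (x + h)) / h\<^sup>2 + g 2 x
        = ((2 * g 0 x - g 0 (x - h) - g 0 (x + h)) + h\<^sup>2 * g 2 x) / h\<^sup>2"
      using h by (simp add: add_divide_distrib)
    then show ?thesis by (simp only: abs_divide abs_power2)
  qed
  ultimately show "\<bar>(2 * g 0 x - g 0 (x - h) - g 0 (x + h)) / h\<^sup>2 + g 2 x\<bar> \<le> K4 * h\<^sup>2"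
    by linarith
  have "\<bar>g 0 (x + h) - g 0 (x - h) - 2 * h * g 1 x\<bar> \<le> K3 * h ^ 3 / 2 + K3 * h ^ 3 / 2"
  proof -
    have "\<bar>g 0 (x + h) - (g 0 x + g 1 x * h + g 2 x * h\<^sup>2 / 2)\<bar> \<le> K3 * h ^ 3 / 2"
      using T2[OF z(1)] h by simp
    moreover have "\<bar>g 0 (x - h) - (g 0 x - g 1 x * h + g 2 x * h\<^sup>2 / 2)\<bar> \<le> K3 * h ^ 3 / 2"
      using T2[OF z(2)] h by simp
    moreover have "2 * h * g 1 x = 2 * (g 1 x * h)" by simp
    ultimately show ?thesis
      unfolding abs_le_iff by linarith
  qed
  also have "\<dots> \<le> 2 * h * (K3 * h\<^sup>2)"
    using \<open>0 \<le> K3\<close> h by (simp add: eval_nat_numeral)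
  finally have "\<bar>g 0 (x + h) - g 0 (x - h) - 2 * h * g 1 x\<bar> / (2 * h) \<le> K3 * h\<^sup>2"
    using h by (simp add: divide_le_eq mult.commute)
  moreover have "\<bar>g 0 (x + h) - g 0 (x - h) - 2 * h * g 1 x\<bar> / (2 * h)
      = \<bar>(g 0 (x + h) - g 0 (x - h)) / (2 * h) - g 1 x\<bar>"
  proof -
    have "(g 0 (x + h) - g 0 (x - h)) / (2 * h) - g 1 x = (g 0 (x + h) - g 0 (x - h) - 2 * h * g 1 x) / (2 * h)"
      using h by (simp add: diff_divide_distrib)
    moreover have "\<bar>2 * h\<bar> = 2 * h" using h by simp
    ultimately show ?thesis by (simp only: abs_divide)
  qed
  ultimately show "\<bar>(g 0 (x + h) - g 0 (x - h)) / (2 * h) - g 1 x\<bar> \<le> K3 * h\<^sup>2"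
    by linarith
qed

section \<open>Regularity and truncation errors of the exact solution\<close>

lemma partial_x_has_derivative:
  assumes "sufficiently_smooth T u" "j < 4" "x \<in> {0..1}" "t \<in> {0..T}"
  shows "((\<lambda>y. partial_x j u y t) has_real_derivative partial_x (Suc j) u x t) (at x within {0..1})"
  using assms
  by (simp add: sufficiently_smooth_def has_real_derivative_iff_has_vector_derivative
      vector_derivative_works[symmetric])

lemma partial_t_has_derivative:
  assumes "sufficiently_smooth T u" "j < 2" "x \<in> {0..1}" "t \<in> {0..T}"
  shows "((\<lambda>s. partial_t T j u x s) has_real_derivative partial_t T (Suc j) u x t) (at t within {0..T})"
  using assms
  by (simp add: sufficiently_smooth_def has_real_derivative_iff_has_vector_derivative
      vector_derivative_works[symmetric])

lemma partial_x_le_Linf_norm: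
  assumes "sufficiently_smooth T u" "0 < T" "j \<le> 4" "x \<in> {0..1}" "t \<in> {0..T}"
  shows "\<bar>partial_x j u x t\<bar> \<le> Linf_norm T (partial_x j u)"
  using assms by (intro abs_le_Linf_norm) (auto simp: sufficiently_smooth_def)

lemma partial_t_le_Linf_norm:
  assumes "sufficiently_smooth T u" "0 < T" "j \<le> 2" "x \<in> {0..1}" "t \<in> {0..T}"
  shows "\<bar>partial_t T j u x t\<bar> \<le> Linf_norm T (partial_t T j u)"
  using assms by (intro abs_le_Linf_norm) (auto simp: sufficiently_smooth_def)

lemma Linf_norm_partial_nonneg:
  assumes "sufficiently_smooth T u" "0 < T"
  shows "j \<le> 4 \<Longrightarrow> 0 \<le> Linf_norm T (partial_x j u)"
    and "j \<le> 2 \<Longrightarrow> 0 \<le> Linf_norm T (partial_t T j u)"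
  using partial_x_le_Linf_norm[OF assms, of j 0 0] partial_t_le_Linf_norm[OF assms, of j 0 0] assms(2)
  by (auto intro: order_trans[OF abs_ge_zero])

lemma grid_0: "grid N 0 = 0"
  by (simp add: grid_def)

lemma grid_Suc_N: "grid N (Suc N) = 1"
  by (simp add: grid_def mesh_def)

lemma grid_shift: "grid N (i + 1) = grid N i + mesh N" "1 \<le> i \<Longrightarrow> grid N (i - 1) = grid N i - mesh N"
  by (auto simp: grid_def algebra_simps of_nat_diff)

lemma grid_in_unit: "i \<le> Suc N \<Longrightarrow> grid N i \<in> {0..1}"
  by (simp add: grid_def mesh_def divide_simps)

text \<open>The error of the first difference is divided by \<open>x\<close> in the stencil. The
  weight \<open>x\<close> compensates this, so the bound is uniform up to the origin.\<close>

lemma stencil_consistency: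
  assumes sm: "sufficiently_smooth T u" and "0 < T" and t: "t \<in> {0..T}" and i: "1 \<le> i" "i \<le> N"
  defines "x \<equiv> grid N i"
  shows "x * \<bar>stencil N (\<lambda>i. u (grid N i) t) i + partial_x 2 u x t + partial_x 1 u x t / x\<bar>
    \<le> (Linf_norm T (partial_x 3 u) + Linf_norm T (partial_x 4 u)) * (mesh N)\<^sup>2"
proof -
  define h where "h = mesh N"
  define g where "g j y = partial_x j u y t" for j y
  define a where "a = (2 * g 0 x - g 0 (x - h) - g 0 (x + h)) / h\<^sup>2 + g 2 x"
  define b where "b = (g 0 (x + h) - g 0 (x - h)) / (2 * h) - g 1 x"
  have x: "0 < x" "x \<le> 1" "x \<in> {0..1}"
    using grid_pos[of i N] grid_in_unit[of i N] i by (auto simp: x_def)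
  have h: "0 < h" "0 \<le> x - h" "x + h \<le> 1"
  proof -
    \<comment> \<open>Both neighbours are grid points, with indices between 0 and
      \<open>N + 1\<close>, hence admissible for the Taylor expansion.\<close>
    have "grid N (i - 1) \<in> {0..1}" "grid N (i + 1) \<in> {0..1}"
      using i by (auto simp del: atLeastAtMost_iff intro!: grid_in_unit)
    then show "0 < h" "0 \<le> x - h" "x + h \<le> 1"
      unfolding grid_shift(1) grid_shift(2)[OF i(1)] h_def x_def using mesh_pos by auto
  qed
  have ab: "\<bar>a\<bar> \<le> Linf_norm T (partial_x 4 u) * h\<^sup>2" "\<bar>b\<bar> \<le> Linf_norm T (partial_x 3 u) * h\<^sup>2"
  proof -
    have der: "(g j has_real_derivative g (Suc j) y) (at y within {0..1})" if "j < 4" "y \<in> {0..1}" for j y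
      using partial_x_has_derivative[OF sm that t] by (simp add: g_def[abs_def])
    have bd: "\<bar>g j y\<bar> \<le> Linf_norm T (partial_x j u)" if "j \<le> 4" "y \<in> {0..1}" for j y
      using partial_x_le_Linf_norm[OF sm \<open>0 < T\<close> that t] by (simp add: g_def)
    show "\<bar>a\<bar> \<le> Linf_norm T (partial_x 4 u) * h\<^sup>2" "\<bar>b\<bar> \<le> Linf_norm T (partial_x 3 u) * h\<^sup>2"
      unfolding a_def b_def using difference_quotient_errors[of g, OF der bd bd h] by simp_all
  qed
  have "stencil N (\<lambda>i. u (grid N i) t) i + partial_x 2 u x t + partial_x 1 u x t / x = a - b / x"
    using i \<open>0 < x\<close> h(1)
    by (simp add: stencil_def grid_shift[simplified] a_def b_def g_def x_def[symmetric] h_def[symmetric]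
        diff_divide_distrib mult_ac)
  then have "x * \<bar>stencil N (\<lambda>i. u (grid N i) t) i + partial_x 2 u x t + partial_x 1 u x t / x\<bar> = \<bar>x * a - b\<bar>"
    using \<open>0 < x\<close> abs_mult[of x "a - b / x"] by (simp add: right_diff_distrib)
  also have "\<dots> \<le> \<bar>a\<bar> + \<bar>b\<bar>"
  proof -
    have "\<bar>x * a\<bar> \<le> 1 * \<bar>a\<bar>" unfolding abs_mult using x by (intro mult_right_mono) auto
    then show ?thesis by linarith
  qed
  finally show ?thesis using ab by (simp add: h_def algebra_simps)
qed

text \<open>The expansion is made backwards from the new time \<open>t + k\<close>, where the
  implicit scheme imposes the equation.\<close>

lemma time_increments:
  assumes sm: "sufficiently_smooth T u" and "0 < T" and x: "x \<in> {0..1}"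
    and t: "t \<in> {0..T}" "t + k \<in> {0..T}" and "0 < k"
  shows "\<bar>u x t - u x (t + k)\<bar> \<le> Linf_norm T (partial_t T 1 u) * k"
    and "\<bar>(u x (t + k) - u x t) / k - partial_t T 1 u x (t + k)\<bar> \<le> Linf_norm T (partial_t T 2 u) * k"
proof -
  define g where "g j s = partial_t T j u x s" for j s
  define L where "L j = Linf_norm T (partial_t T j u)" for j
  have der: "(g j has_real_derivative g (Suc j) s) (at s within {0..T})" if "j \<le> 1" "s \<in> {0..T}" for j s
    using partial_t_has_derivative[OF sm _ x] that by (simp add: g_def[abs_def])
  have bd: "\<bar>g j s\<bar> \<le> L j" if "j \<le> 2" "s \<in> {0..T}" for j s
    using partial_t_le_Linf_norm[OF sm \<open>0 < T\<close> _ x] that by (simp add: g_def L_def)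
  show "\<bar>u x t - u x (t + k)\<bar> \<le> Linf_norm T (partial_t T 1 u) * k"
  proof -
    have "\<bar>g 0 t - g 0 (t + k)\<bar> \<le> L 1 * k"
      using field_Taylor[of "{0..T}" 0 g "L 1" "t + k" t] der bd t \<open>0 < k\<close> by simp
    then show ?thesis by (simp add: g_def L_def)
  qed
  have "\<bar>g 0 t - (g 0 (t + k) - g 1 (t + k) * k)\<bar> \<le> L 2 * k\<^sup>2"
    using field_Taylor[of "{0..T}" 1 g "L 2" "t + k" t] der bd t \<open>0 < k\<close>
    by (simp add: eval_nat_numeral)
  then have "\<bar>u x t - (u x (t + k) - g 1 (t + k) * k)\<bar> \<le> Linf_norm T (partial_t T 2 u) * k\<^sup>2"
    by (simp add: g_def L_def)
  then have "\<bar>u x t - (u x (t + k) - g 1 (t + k) * k)\<bar> / k \<le> Linf_norm T (partial_t T 2 u) * k"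
    using \<open>0 < k\<close> by (simp add: divide_le_eq power2_eq_square mult_ac)
  moreover have "\<bar>u x t - (u x (t + k) - g 1 (t + k) * k)\<bar> / k
      = \<bar>(u x (t + k) - u x t) / k - g 1 (t + k)\<bar>"
  proof -
    have "(u x (t + k) - u x t) / k - g 1 (t + k) = - ((u x t - (u x (t + k) - g 1 (t + k) * k)) / k)"
      using \<open>0 < k\<close> by (simp add: field_simps)
    then show ?thesis using \<open>0 < k\<close> by (simp add: abs_divide)
  qed
  ultimately show "\<bar>(u x (t + k) - u x t) / k - partial_t T 1 u x (t + k)\<bar> \<le> Linf_norm T (partial_t T 2 u) * k"
    by (simp add: g_def)
qed

text \<open>The boundary value at \<open>x = 0\<close> vanishes. This tames the coefficient
  \<open>1 / x\<^sup>2\<close>: after weighting with \<open>x\<close>, only the bounded quotient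
  \<open>u / x\<close> is left.\<close>

lemma abs_solution_le:
  assumes sm: "sufficiently_smooth T u" and sol: "continuous_solution T u0 u" and "0 < T"
    and x: "x \<in> {0..1}" and t: "t \<in> {0..T}"
  shows "\<bar>u x t\<bar> \<le> Linf_norm T (partial_x 1 u) * x"
  using field_Taylor[of "{0..1}" 0 "\<lambda>j y. partial_x j u y t" "Linf_norm T (partial_x 1 u)" 0 x]
    partial_x_has_derivative[OF sm, of 0 _ t] partial_x_le_Linf_norm[OF sm \<open>0 < T\<close>, of 1 _ t] x t sol
  by (simp add: continuous_solution_def)

text \<open>Here \<open>w\<close> stands for the numerical value at the old time \<open>t\<close>.
  The residual splits into the time error \<open>A\<close>, the space error \<open>B\<close> and the
  error \<open>C\<close> of freezing \<open>sinc\<close> at \<open>w\<close> instead of the exact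
  new value \<open>v\<close>. By the Lipschitz bound, \<open>C\<close> yields the old error
  \<open>\<bar>u x t - w\<bar>\<close> plus one time increment.\<close>

lemma scheme_residual:
  fixes T k t :: real and N i :: nat and w :: real
  assumes sm: "sufficiently_smooth T u" and sol: "continuous_solution T u0 u" and "0 < T"
    and i: "1 \<le> i" "i \<le> N" and t: "t \<in> {0..T}" "t + k \<in> {0..T}" and "0 < k"
  defines "x \<equiv> grid N i"
  defines "K1 \<equiv> Linf_norm T (partial_x 1 u)" and "K3 \<equiv> Linf_norm T (partial_x 3 u)"
    and "K4 \<equiv> Linf_norm T (partial_x 4 u)"
    and "L1 \<equiv> Linf_norm T (partial_t T 1 u)" and "L2 \<equiv> Linf_norm T (partial_t T 2 u)"
  shows "x * \<bar>(u x (t + k) - u x t) / k + stencil N (\<lambda>i. u (grid N i) (t + k)) i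
      + sinc (2 * w) * u x (t + k) / x\<^sup>2\<bar>
    \<le> ((L2 + 2 * K1 * L1) * k + (K3 + K4) * (mesh N)\<^sup>2) + 2 * K1 * \<bar>u x t - w\<bar>"
proof -
  have x: "0 < x" "x \<le> 1" "x \<in> {0..1}"
    using grid_pos[of i N] grid_in_unit[of i N] i by (auto simp: x_def)
  define v where "v = u x (t + k)"
  define A where "A = (v - u x t) / k - partial_t T 1 u x (t + k)"
  define B where "B = stencil N (\<lambda>i. u (grid N i) (t + k)) i
    + partial_x 2 u x (t + k) + partial_x 1 u x (t + k) / x"
  define C where "C = (sinc (2 * w) - sinc (2 * v)) * v / x\<^sup>2"
  \<comment> \<open>The nonlinearity is rewritten by
    \<open>sin (2 * v) = 2 * v * sinc (2 * v)\<close>, which also holds at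
    \<open>v = 0\<close>.\<close>
  have pde: "partial_t T 1 u x (t + k) = partial_x 2 u x (t + k) + partial_x 1 u x (t + k) / x
      - sinc (2 * v) * v / x\<^sup>2"
    using sol x t by (simp add: continuous_solution_def v_def)
  have split: "(v - u x t) / k + stencil N (\<lambda>i. u (grid N i) (t + k)) i + sinc (2 * w) * v / x\<^sup>2
      = A + B + C"
    unfolding A_def B_def C_def pde by (simp add: algebra_simps diff_divide_distrib)
  have "x * \<bar>A\<bar> \<le> 1 * (L2 * k)"
    using time_increments(2)[OF sm \<open>0 < T\<close> x(3) t \<open>0 < k\<close>] x
    unfolding A_def v_def L2_def by (intro mult_mono) auto
  moreover have "x * \<bar>B\<bar> \<le> (K3 + K4) * (mesh N)\<^sup>2"
    using stencil_consistency[OF sm \<open>0 < T\<close> t(2) i] unfolding B_def K3_def K4_def x_def .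
  moreover have "x * \<bar>C\<bar> \<le> 2 * K1 * (\<bar>u x t - w\<bar> + L1 * k)"
  proof -
    have v: "\<bar>v\<bar> / x \<le> K1"
      using abs_solution_le[OF sm sol \<open>0 < T\<close> x(3) t(2)] x
      by (simp add: v_def K1_def divide_le_eq)
    have "\<bar>sinc (2 * w) - sinc (2 * v)\<bar> \<le> 2 * \<bar>w - v\<bar>"
      using sinc_Lipschitz[of "2 * w" "2 * v"] by (simp add: abs_if split: if_splits)
    also have "\<bar>w - v\<bar> \<le> \<bar>u x t - w\<bar> + \<bar>u x t - v\<bar>"
      by arith
    also have "\<bar>u x t - v\<bar> \<le> L1 * k"
      using time_increments(1)[OF sm \<open>0 < T\<close> x(3) t \<open>0 < k\<close>] unfolding v_def L1_def .
    finally have "\<bar>sinc (2 * w) - sinc (2 * v)\<bar> * (\<bar>v\<bar> / x) \<le> 2 * (\<bar>u x t - w\<bar> + L1 * k) * K1"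
      using v x by (intro mult_mono) auto
    moreover have "x * \<bar>C\<bar> = \<bar>sinc (2 * w) - sinc (2 * v)\<bar> * (\<bar>v\<bar> / x)"
      unfolding C_def abs_mult abs_divide using x by (simp add: power2_eq_square)
    ultimately show ?thesis by (simp add: mult_ac)
  qed
  moreover have "x * \<bar>A + B + C\<bar> \<le> x * \<bar>A\<bar> + x * \<bar>B\<bar> + x * \<bar>C\<bar>"
  proof -
    have "x * \<bar>A + B + C\<bar> \<le> x * (\<bar>A\<bar> + \<bar>B\<bar> + \<bar>C\<bar>)" using x by (intro mult_left_mono) auto
    then show ?thesis by (simp add: distrib_left)
  qed
  ultimately have "x * \<bar>A + B + C\<bar> \<le> L2 * k + (K3 + K4) * (mesh N)\<^sup>2 + 2 * K1 * (\<bar>u x t - w\<bar> + L1 * k)"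
    by linarith
  also have "\<dots> = ((L2 + 2 * K1 * L1) * k + (K3 + K4) * (mesh N)\<^sup>2) + 2 * K1 * \<bar>u x t - w\<bar>"
    by (simp add: algebra_simps)
  finally show ?thesis unfolding split[symmetric] v_def .
qed

section \<open>Invariance of the interval of admissible values\<close>

lemma sinc_le_sinc_if_abs_le:
  assumes "\<bar>y\<bar> \<le> c" "c \<le> pi / 2"
  shows "sinc (2 * c) \<le> sinc (2 * y)"
proof -
  have "sinc (2 * c) \<le> sinc (2 * \<bar>y\<bar>)"
    using assms by (intro sinc_antimono) auto
  also have "sinc (2 * \<bar>y\<bar>) = sinc (2 * y)"
    by (simp add: abs_if)
  finally show ?thesis .
qed

text \<open>Bound and sign propagate together: values in \<open>[-c, c]\<close> at one time level
  make the lagged coefficient \<open>sinc (2 * w)\<close> nonnegative, and then the maximum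
  principle carries the bound to the next level.\<close>

lemma discrete_solution_bounded:
  assumes sol: "discrete_solution T u0 N M U" and "0 < T" "1 \<le> N"
    and c: "0 < c" "c \<le> pi / 2" "0 \<le> sinc (2 * c)" "max_norm (U 0) \<le> c"
    and "n \<le> M" "i \<le> Suc N"
  shows "\<bar>zero_ext N (U n) i\<bar> \<le> c"
  using \<open>n \<le> M\<close> \<open>i \<le> Suc N\<close>
proof (induction n arbitrary: i)
  case 0
  have dim: "dim_vec (U 0) = N" using sol by (auto simp: discrete_solution_def)
  show ?case
  proof (cases "1 \<le> i \<and> i \<le> N")
    case True
    then have "\<bar>vec_index (U 0) (i - 1)\<bar> \<le> max_norm (U 0)"
      unfolding max_norm_def dim by (intro Max_ge) auto
    then show ?thesis using c True by (simp add: zero_ext_def)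
  qed (use c in \<open>auto simp: zero_ext_def\<close>)
next
  case (Suc n)
  define w where "w = zero_ext N (U n)"
  have IH: "\<bar>w j\<bar> \<le> c" if "j \<le> Suc N" for j
    using Suc that by (simp add: w_def)
  show ?case
  proof (rule stencil_max_principle[where w = w and k = "T / real M" and N = N
        and q = "\<lambda>i. sinc (2 * w i) / (grid N i)\<^sup>2"])
    fix j assume j: "1 \<le> j" "j \<le> N"
    show "(zero_ext N (U (Suc n)) j - w j) / (T / real M) =
        - stencil N (zero_ext N (U (Suc n))) j - sinc (2 * w j) / (grid N j)\<^sup>2 * zero_ext N (U (Suc n)) j"
      using discrete_solution_pointwise[OF sol _ j \<open>0 < T\<close>, of n] Suc.prems by (simp add: w_def)
    have "sinc (2 * c) \<le> sinc (2 * w j)"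
      using IH[of j] j c by (intro sinc_le_sinc_if_abs_le) auto
    then have "0 \<le> sinc (2 * w j)" using c(3) by (rule order_trans[rotated])
    then show "0 \<le> sinc (2 * w j) / (grid N j)\<^sup>2" by (rule divide_nonneg_nonneg) simp
  qed (use IH Suc.prems c \<open>0 < T\<close> in \<open>auto simp: zero_ext_def\<close>)
qed

section \<open>Convergence\<close>

lemma norm_D_eq: "norm_D N v = sqrt (energy N (zero_ext N v))"
proof -
  have "(\<Sum>i=1..N. grid N i * (zero_ext N v i)\<^sup>2) = (\<Sum>i<N. grid N (Suc i) * (vec_index v i)\<^sup>2)"
    unfolding One_nat_def sum.atLeast1_atMost_eq by (simp add: zero_ext_def)
  then show ?thesis by (simp add: norm_D_def energy_def)
qed

text \<open>The estimate has the rate \<open>k + h\<^sup>2\<close> without a logarithm. It is the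
  square root of the Gronwall bound for the energy of the error.\<close>

lemma error_bound:
  assumes sm: "sufficiently_smooth T u" and csol: "continuous_solution T u0 u" and "0 < T"
    and dsol: "discrete_solution T u0 N M U" and "1 \<le> N" "1 \<le> M"
    and c: "0 < c" "c \<le> pi / 2" "1/4 \<le> sinc (2 * c)" "max_norm (U 0) \<le> c" and "n \<le> M"
  defines "K1 \<equiv> Linf_norm T (partial_x 1 u)" and "K3 \<equiv> Linf_norm T (partial_x 3 u)"
    and "K4 \<equiv> Linf_norm T (partial_x 4 u)"
    and "L1 \<equiv> Linf_norm T (partial_t T 1 u)" and "L2 \<equiv> Linf_norm T (partial_t T 2 u)"
  shows "norm_D N (grid_vec N (\<lambda>x. u x (real n * (T / real M))) - U n)
    \<le> 2 * sqrt T * exp (8 * K1\<^sup>2 * T) *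
      ((L2 + 2 * K1 * L1) * (T / real M) + (K3 + K4) * (mesh N)\<^sup>2)"
proof -
  define k where "k = T / real M"
  have "0 < k" using \<open>0 < T\<close> \<open>1 \<le> M\<close> by (simp add: k_def)
  define E where "E = (L2 + 2 * K1 * L1) * k + (K3 + K4) * (mesh N)\<^sup>2"
  define V where "V n i = u (grid N i) (real n * k)" for n i
  define W where "W n = zero_ext N (U n)" for n
  define e where "e n i = V n i - W n i" for n i
  have time: "real n * k \<in> {0..T}" if "n \<le> M" for n
    using that \<open>0 < T\<close> \<open>1 \<le> M\<close> by (simp add: k_def divide_simps mult.commute)
  have nn: "0 \<le> K1" "0 \<le> K3" "0 \<le> K4" "0 \<le> L1" "0 \<le> L2"
    unfolding K1_def K3_def K4_def L1_def L2_def using Linf_norm_partial_nonneg[OF sm \<open>0 < T\<close>]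
      by (simp_all del: partial_x.simps partial_t.simps)
  then have "0 \<le> E" using \<open>0 < k\<close> by (simp add: E_def)
  have bdry: "e n 0 = 0" "e n (Suc N) = 0" if "n \<le> M" for n
    using csol time[OF that] by (auto simp: e_def V_def W_def zero_ext_def grid_0 grid_Suc_N continuous_solution_def)
  have step: "energy N (e (Suc n)) \<le> (1 + 4 * k * (2 * K1)\<^sup>2) * energy N (e n) + 4 * k * E\<^sup>2"
    if n: "n < M" for n
  \<comment> \<open>The exact values \<open>V\<close> are inserted into the scheme with the
    coefficient of the numerical solution \<open>W\<close>. Both then share one linear operator, and
    the difference of the equations is linear in \<open>e\<close>.\<close>
  proof (rule energy_step[where k = k and g = "\<lambda>i. sinc (2 * W n i)" and
      \<rho> = "\<lambda>i. (V (Suc n) i - V n i) / k + stencil N (V (Suc n)) i + sinc (2 * W n i) * V (Suc n) i / (grid N i)\<^sup>2"])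
    fix i assume i: "1 \<le> i" "i \<le> N"
    have lin: "stencil N (e (Suc n)) i = stencil N (V (Suc n)) i - stencil N (W (Suc n)) i"
      by (simp add: stencil_def e_def diff_divide_distrib add_divide_distrib algebra_simps)
    show "(e (Suc n) i - e n i) / k + stencil N (e (Suc n)) i + sinc (2 * W n i) * e (Suc n) i / (grid N i)\<^sup>2
       = (V (Suc n) i - V n i) / k + stencil N (V (Suc n)) i + sinc (2 * W n i) * V (Suc n) i / (grid N i)\<^sup>2"
      using discrete_solution_pointwise[OF dsol n i \<open>0 < T\<close>, folded k_def W_def]
      unfolding lin unfolding e_def by (simp add: diff_divide_distrib right_diff_distrib)
    have "sinc (2 * c) \<le> sinc (2 * W n i)"
      unfolding W_def using c n i \<open>0 < T\<close> \<open>1 \<le> N\<close>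
      by (intro sinc_le_sinc_if_abs_le discrete_solution_bounded[OF dsol]) auto
    then show "1/4 \<le> sinc (2 * W n i)" using c(3) by (rule order_trans[rotated])
    have "real n * k + k = real (Suc n) * k" by (simp add: algebra_simps)
    then show "grid N i * \<bar>(V (Suc n) i - V n i) / k + stencil N (V (Suc n)) i
        + sinc (2 * W n i) * V (Suc n) i / (grid N i)\<^sup>2\<bar> \<le> E + 2 * K1 * \<bar>e n i\<bar>"
      using scheme_residual[OF sm csol \<open>0 < T\<close> i, of "real n * k" k "W n i"]
        time[of n] time[of "Suc n"] n \<open>0 < k\<close>
      unfolding e_def V_def[abs_def] E_def K1_def K3_def K4_def L1_def L2_def by simp
  qed (use bdry n \<open>0 < k\<close> in auto)
  have "e 0 i = 0" if "1 \<le> i" "i \<le> N" for i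
    using csol dsol that grid_in_unit[of i N]
    by (cases i) (simp_all add: e_def V_def W_def zero_ext_def continuous_solution_def
        discrete_solution_def grid_vec_def)
  then have "energy N (e 0) = 0"
    by (simp add: energy_def)
  \<comment> \<open>Gronwall with \<open>p = 4 * k * (2 * K1)\<^sup>2\<close> and
    \<open>q = 4 * k * E\<^sup>2\<close>; below, \<open>n * k \<le> T\<close> removes the step size,
    and the square root halves the exponent.\<close>
  then have "energy N (e n) \<le> real n * (4 * k * E\<^sup>2) * exp (4 * k * (2 * K1)\<^sup>2 * real n)"
    using step \<open>n \<le> M\<close> \<open>0 < k\<close> by (intro discrete_Gronwall[where M = M]) auto
  also have "\<dots> = 4 * (real n * k) * E\<^sup>2 * exp (16 * K1\<^sup>2 * (real n * k))"
    by (simp add: power_mult_distrib mult_ac)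
  also have "\<dots> \<le> 4 * T * E\<^sup>2 * exp (16 * K1\<^sup>2 * T)"
    using time[OF \<open>n \<le> M\<close>] by (intro mult_mono) (auto intro: mult_left_mono)
  also have "\<dots> = (2 * sqrt T * exp (8 * K1\<^sup>2 * T) * E)\<^sup>2"
    using \<open>0 < T\<close> by (simp add: power_mult_distrib exp_double[symmetric])
  finally have "sqrt (energy N (e n)) \<le> 2 * sqrt T * exp (8 * K1\<^sup>2 * T) * E"
    using \<open>0 \<le> E\<close> \<open>0 < T\<close> by (intro real_le_lsqrt) auto
  moreover have "zero_ext N (grid_vec N (\<lambda>x. u x (real n * (T / real M))) - U n) i = e n i"
    if "1 \<le> i" "i \<le> N" for i
  proof -
    have "dim_vec (U n) = N" using dsol \<open>n \<le> M\<close> by (auto simp: discrete_solution_def)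
    then show ?thesis using that by (simp add: zero_ext_def e_def V_def W_def grid_vec_def k_def)
  qed
  then have "norm_D N (grid_vec N (\<lambda>x. u x (real n * (T / real M))) - U n) = sqrt (energy N (e n))"
    unfolding norm_D_eq energy_def by simp
  ultimately show ?thesis by (simp add: E_def k_def)
qed

text \<open>Since \<open>mesh N \<le> 1/2\<close>, the estimate \<open>ln h \<le> h - 1\<close>
  keeps the logarithm away from 0. This allows the logarithmic factor to be inserted into a bound
  that lacks it.\<close>

lemma half_le_abs_ln_mesh_powr:
  assumes "1 \<le> N"
  shows "1/2 \<le> \<bar>ln (mesh N)\<bar> powr (1/2)"
proof -
  have "mesh N \<le> 1/2" using assms by (simp add: mesh_def divide_simps)
  have "ln (mesh N) \<le> mesh N - 1" by (rule ln_le_minus_one) (rule mesh_pos)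
  then have "1/4 \<le> \<bar>ln (mesh N)\<bar>" using \<open>mesh N \<le> 1/2\<close> by linarith
  then have "sqrt (1/4) \<le> sqrt \<bar>ln (mesh N)\<bar>" by (rule real_sqrt_le_mono)
  then show ?thesis by (simp add: powr_half_sqrt real_sqrt_divide)
qed

theorem theorem4p2:
  shows "\<exists>c :: real list \<Rightarrow> real list \<Rightarrow> real \<Rightarrow> real \<Rightarrow> real \<Rightarrow> real \<Rightarrow> real.
    \<forall>(\<alpha>::real) (c\<^sub>\<alpha>::real) (T::real) (u0::real \<Rightarrow> real) (u::real \<Rightarrow> real \<Rightarrow> real)
      (N::nat) (M::nat) (U::nat \<Rightarrow> real vec).
      1/2 < \<alpha> \<and> \<alpha> < 1 \<and>
      0 < c\<^sub>\<alpha> \<and> c\<^sub>\<alpha> \<le> pi / 2 \<and> sin (2 * c\<^sub>\<alpha>) / (2 * c\<^sub>\<alpha>) = \<alpha>\<^sup>2 \<and>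
      0 < T \<and> sufficiently_smooth T u \<and> continuous_solution T u0 u \<and>
      1 \<le> N \<and> 1 \<le> M \<and> discrete_solution T u0 N M U \<and>
      max_norm (U 0) \<le> c\<^sub>\<alpha> \<longrightarrow>
      (\<forall>n. 1 \<le> n \<and> n \<le> M \<longrightarrow>
        norm_D N (grid_vec N (\<lambda>x. u x (real n * (T / real M))) - U n)
          \<le> c (map (\<lambda>j. Linf_norm T (partial_x j u)) [0..<5])
              (map (\<lambda>j. Linf_norm T (partial_t T j u)) [0..<3])
              T \<alpha> c\<^sub>\<alpha> (max_norm (D_powr N (- \<alpha>) *\<^sub>v U 0))
            * (T / real M + (mesh N)\<^sup>2 * \<bar>ln (mesh N)\<bar> powr (1/2)))"
proof -
  \<comment> \<open>Entry \<open>j\<close> of each list is the norm of the derivative of order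
    \<open>j\<close>. The expression is the constant of \<open>error_bound\<close>, with a further
    factor 2 that offsets the lower bound \<open>1/2\<close> for the logarithmic factor.\<close>
  define c :: "real list \<Rightarrow> real list \<Rightarrow> real \<Rightarrow> real \<Rightarrow> real \<Rightarrow> real \<Rightarrow> real" where
    "c = (\<lambda>xs ts T \<alpha> c\<^sub>\<alpha> d. 2 * sqrt T * exp (8 * (xs ! 1)\<^sup>2 * T) *
      (2 * ((ts ! 2 + 2 * xs ! 1 * ts ! 1) + (xs ! 3 + xs ! 4))))"
  have "norm_D N (grid_vec N (\<lambda>x. u x (real n * (T / real M))) - U n)
          \<le> c (map (\<lambda>j. Linf_norm T (partial_x j u)) [0..<5])
              (map (\<lambda>j. Linf_norm T (partial_t T j u)) [0..<3])
              T \<alpha> c\<^sub>\<alpha> (max_norm (D_powr N (- \<alpha>) *\<^sub>v U 0))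
            * (T / real M + (mesh N)\<^sup>2 * \<bar>ln (mesh N)\<bar> powr (1/2))"
    if \<alpha>: "1/2 < \<alpha>" and c\<^sub>\<alpha>: "0 < c\<^sub>\<alpha>" "c\<^sub>\<alpha> \<le> pi / 2" "sin (2 * c\<^sub>\<alpha>) / (2 * c\<^sub>\<alpha>) = \<alpha>\<^sup>2"
      and T: "0 < T" and sm: "sufficiently_smooth T u" and csol: "continuous_solution T u0 u"
      and NM: "1 \<le> N" "1 \<le> M" and dsol: "discrete_solution T u0 N M U"
      and U0: "max_norm (U 0) \<le> c\<^sub>\<alpha>" and n: "n \<le> M"
    for \<alpha> c\<^sub>\<alpha> T u0 u N M U n
  proof -
    define K1 K3 K4 where K: "K1 = Linf_norm T (partial_x 1 u)" "K3 = Linf_norm T (partial_x 3 u)"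
      "K4 = Linf_norm T (partial_x 4 u)"
    define L1 L2 where L: "L1 = Linf_norm T (partial_t T 1 u)" "L2 = Linf_norm T (partial_t T 2 u)"
    have nn: "0 \<le> K1" "0 \<le> K3" "0 \<le> K4" "0 \<le> L1" "0 \<le> L2"
      unfolding K L using Linf_norm_partial_nonneg[OF sm T]
      by (simp_all del: partial_x.simps partial_t.simps)
    have nth: "map f [0..<5] ! 1 = f 1" "map f [0..<5] ! 3 = f 3" "map f [0..<5] ! 4 = f 4"
      "map f [0..<3] ! 1 = f 1" "map f [0..<3] ! 2 = f 2" for f :: "nat \<Rightarrow> real"
      by (simp_all add: numeral_2_eq_2)
    let ?k = "T / real M" and ?h = "(mesh N)\<^sup>2 * \<bar>ln (mesh N)\<bar> powr (1/2)"
    have "0 \<le> ?k" using T by simp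
    \<comment> \<open>The hypothesis \<open>1/2 < \<alpha>\<close> supplies the threshold
      \<open>1/4\<close> for the reaction coefficient in the energy estimate.\<close>
    have "(1/2)\<^sup>2 \<le> \<alpha>\<^sup>2" using \<alpha> by (intro power_mono) auto
    then have "1/4 \<le> sinc (2 * c\<^sub>\<alpha>)" using c\<^sub>\<alpha> by (simp add: power2_eq_square)
    then have "norm_D N (grid_vec N (\<lambda>x. u x (real n * ?k)) - U n) \<le> 2 * sqrt T * exp (8 * K1\<^sup>2 * T) *
        ((L2 + 2 * K1 * L1) * ?k + (K3 + K4) * (mesh N)\<^sup>2)"
      unfolding K L using error_bound[OF sm csol T dsol NM c\<^sub>\<alpha>(1,2) _ U0 n] by simp
    also have "\<dots> \<le> 2 * sqrt T * exp (8 * K1\<^sup>2 * T) *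
        ((2 * ((L2 + 2 * K1 * L1) + (K3 + K4))) * (?k + ?h))"
    proof (rule mult_left_mono)
      \<comment> \<open>To be used with \<open>a\<close> the squared mesh size, \<open>b\<close> the
        time step and \<open>d\<close> the squared mesh size times the logarithmic factor.\<close>
      have "a \<le> 2 * (b + d) \<and> b \<le> 2 * (b + d)" if "a * (1/2) \<le> d" "0 \<le> d" "0 \<le> b" for a b d :: real
        using that by simp
      from this[OF mult_left_mono[OF half_le_abs_ln_mesh_powr[OF NM(1)]] _ \<open>0 \<le> ?k\<close>, of "(mesh N)\<^sup>2"]
      have h: "(mesh N)\<^sup>2 \<le> 2 * (?k + ?h)" and k: "?k \<le> 2 * (?k + ?h)"
        by simp_all
      have "(L2 + 2 * K1 * L1) * ?k + (K3 + K4) * (mesh N)\<^sup>2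
          \<le> (L2 + 2 * K1 * L1) * (2 * (?k + ?h)) + (K3 + K4) * (2 * (?k + ?h))"
        using nn by (intro add_mono mult_left_mono h k) auto
      also have "a * (2 * s) + b * (2 * s) = (2 * (a + b)) * s" for a b s :: real
        by (simp add: algebra_simps)
      finally show "(L2 + 2 * K1 * L1) * ?k + (K3 + K4) * (mesh N)\<^sup>2
          \<le> (2 * ((L2 + 2 * K1 * L1) + (K3 + K4))) * (?k + ?h)" .
    qed (use T in auto)
    finally show ?thesis
      unfolding c_def nth K[symmetric] L[symmetric] mult.assoc .
  qed
  then show ?thesis by blast
qed

end
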